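(* Let $L$ be a Fomin lattice with minimum element $\hat{0}$, value set $V=\mathbb{Z}$, differential degree $r>0$ and weighting $w$, and suppose that for every covering $x\lessdot y$ with $w(x\lessdot y)<0$ there exist $z,v\in L$ with $z\lessdot v\le x$ and $w(z\lessdot v)=0$. Then the truncation $L_/$ (with differential degree $r$ and weighting the restriction of $w$) is a Fomin lattice with minimum element $\hat{0}$ whose weighting is positive.
   Context: A Fomin lattice consists of: a lattice $L$ that is modular, locally finite, and in which every element has finitely many upper covers and finitely many lower covers; a module $V$ (the set of values) over a unital ring; an element $r\in V$ (the differential degree); and a function $w$ assigning to every covering $x\lessdot y$ of $L$ a value in $V$, such that (a) for all $x\in L$, $\sum_{y\lessdot x} w(y\lessdot x)+r=\sum_{x\lessdot z}w(x\lessdot z)$, and (b) $w$ is projective-constant: whenever $x\vee y$ covers both $x$ and $y$ and $x\wedge y$ is covered by both, then $w(x\wedge y\lessdot x)=w(y\lessdot x\vee y)$ and $w(x\wedge y\lessdot y)=w(x\lessdot x\vee y)$. A weighting is positive if $V=\mathbb{Z}$, all its values are positive integers and $r>0$. Let $S$ be the set of coverings with $w$-value $0$; $x\sim y$ means no covering in a maximal chain from $x\wedge y$ to $x\vee y$ lies in $S$ (independent of the chain). The truncation $L_/$ is $\{x\in L: x\sim\hat{0}\}$. *)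

theory Defs
  imports "HOL-Algebra.Lattice"
begin

definition covering :: "('a, 'm) gorder_scheme \<Rightarrow> 'a \<Rightarrow> 'a \<Rightarrow> bool" (infix \<open>\<lessdot>\<index>\<close> 50)
  where "x \<lessdot>\<^bsub>L\<^esub> y \<longleftrightarrow> x \<in> carrier L \<and> y \<in> carrier L \<and> x \<sqsubset>\<^bsub>L\<^esub> y \<and>
    (\<forall>z \<in> carrier L. \<not> (x \<sqsubset>\<^bsub>L\<^esub> z \<and> z \<sqsubset>\<^bsub>L\<^esub> y))"

locale modular_lattice = lattice +
  assumes modular: "\<lbrakk>x \<in> carrier L; y \<in> carrier L; z \<in> carrier L; x \<sqsubseteq> z\<rbrakk>
    \<Longrightarrow> x \<squnion> (y \<sqinter> z) = (x \<squnion> y) \<sqinter> z"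

text \<open>
  The module of values enters the axioms only through its addition, so the values live in an
  arbitrary additive abelian group (every such group is a module over the integers, and every
  module has an underlying one).

  A weighting is a function on coverings; here \<open>w\<close> is total, but \<open>w x y\<close> is used only when
  \<open>y\<close> covers \<open>x\<close> in \<open>L\<close>. Hence the restriction of a weighting to a sub-order of \<open>L\<close> is given
  by the same \<open>w\<close>.
\<close>

locale fomin_lattice = modular_lattice +
  fixes w :: "'a \<Rightarrow> 'a \<Rightarrow> 'v::ab_group_add"
    and r :: 'v
  assumes locally_finite: "\<lbrakk>x \<in> carrier L; y \<in> carrier L\<rbrakk> \<Longrightarrow> finite \<lbrace>x..y\<rbrace>"
    and finite_upper_covers: "x \<in> carrier L \<Longrightarrow> finite {z. x \<lessdot> z}"
    and finite_lower_covers: "x \<in> carrier L \<Longrightarrow> finite {y. y \<lessdot> x}"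
    and differential:
      "x \<in> carrier L \<Longrightarrow> (\<Sum>y\<in>{y. y \<lessdot> x}. w y x) + r = (\<Sum>z\<in>{z. x \<lessdot> z}. w x z)"
    and projective_constant:
      "\<lbrakk>x \<in> carrier L; y \<in> carrier L;
        x \<lessdot> x \<squnion> y; y \<lessdot> x \<squnion> y; x \<sqinter> y \<lessdot> x; x \<sqinter> y \<lessdot> y\<rbrakk>
       \<Longrightarrow> w (x \<sqinter> y) x = w y (x \<squnion> y) \<and> w (x \<sqinter> y) y = w x (x \<squnion> y)"

definition positive_weighting ::
    "('a, 'm) gorder_scheme \<Rightarrow> ('a \<Rightarrow> 'a \<Rightarrow> int) \<Rightarrow> int \<Rightarrow> bool"
  where "positive_weighting L w r \<longleftrightarrow> (\<forall>x y. x \<lessdot>\<^bsub>L\<^esub> y \<longrightarrow> 0 < w x y) \<and> 0 < r"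

definition zero_coverings ::
    "('a, 'm) gorder_scheme \<Rightarrow> ('a \<Rightarrow> 'a \<Rightarrow> 'v::zero) \<Rightarrow> ('a \<times> 'a) set"
  where "zero_coverings L w = {(x, y). x \<lessdot>\<^bsub>L\<^esub> y \<and> w x y = 0}"

definition maximal_chain_between :: "('a, 'm) gorder_scheme \<Rightarrow> 'a \<Rightarrow> 'a \<Rightarrow> 'a set \<Rightarrow> bool"
  where "maximal_chain_between L a b C \<longleftrightarrow>
    pred_on.maxchain \<lbrace>a..b\<rbrace>\<^bsub>L\<^esub> (\<lambda>x y. x \<sqsubset>\<^bsub>L\<^esub> y) C"

text \<open>
  In a Fomin lattice the condition does not depend on the maximal chain, so asking it
  of some chain is the same as asking it of all of them.
\<close>

definition trunc_rel ::
    "('a, 'm) gorder_scheme \<Rightarrow> ('a \<Rightarrow> 'a \<Rightarrow> 'v::zero) \<Rightarrow> 'a \<Rightarrow> 'a \<Rightarrow> bool"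
  where "trunc_rel L w x y \<longleftrightarrow>
    (\<exists>C. maximal_chain_between L (x \<sqinter>\<^bsub>L\<^esub> y) (x \<squnion>\<^bsub>L\<^esub> y) C \<and>
         (\<forall>u\<in>C. \<forall>v\<in>C. u \<lessdot>\<^bsub>L\<^esub> v \<longrightarrow> (u, v) \<notin> zero_coverings L w))"

text \<open>The truncation, with the order induced from \<open>L\<close>; the last argument is the minimum of \<open>L\<close>.\<close>

definition truncation ::
    "('a, 'm) gorder_scheme \<Rightarrow> ('a \<Rightarrow> 'a \<Rightarrow> 'v::zero) \<Rightarrow> 'a \<Rightarrow> ('a, 'm) gorder_scheme"
  where "truncation L w min0 = L\<lparr>carrier := {x \<in> carrier L. trunc_rel L w x min0}\<rparr>"

end

theory Submission
  imports Defs
begin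

text \<open>
  By modularity, a covering \<open>u \<lessdot> v\<close> keeps its weight when it is transposed to
  \<open>x \<lessdot> v \<squnion> x\<close> with \<open>v \<sqinter> x = u\<close>. As in the Jordan--Hoelder theorem, one zero-free maximal
  chain from the minimum to \<open>x\<close> therefore excludes every zero covering below \<open>x\<close>. So the
  truncation is the set of elements with no zero covering below them, which transposition shows
  to be an ideal. Passing to this ideal loses no lower covers, and the upper covers that it
  loses have weight zero, so the differential condition survives. A negative covering in the
  ideal would have a zero covering below it.
\<close>

section \<open>Coverings in modular lattices\<close>

lemma (in lattice) meet_absorb2:
  "\<lbrakk>x \<in> carrier L; y \<in> carrier L; y \<sqsubseteq> x\<rbrakk> \<Longrightarrow> x \<sqinter> y = y"
  by (metis le_iff_join meet_comm)

lemma (in lattice) join_absorb1: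
  "\<lbrakk>x \<in> carrier L; y \<in> carrier L; y \<sqsubseteq> x\<rbrakk> \<Longrightarrow> x \<squnion> y = x"
  by (metis le_iff_meet join_comm)

lemma (in partial_order) covering_eq:
  "x \<lessdot> y \<longleftrightarrow> x \<in> carrier L \<and> y \<in> carrier L \<and> x \<sqsubseteq> y \<and> x \<noteq> y \<and>
    (\<forall>z\<in>carrier L. x \<sqsubseteq> z \<longrightarrow> z \<sqsubseteq> y \<longrightarrow> z = x \<or> z = y)"
  unfolding covering_def lless_eq by blast

lemma (in partial_order) coveringD:
  assumes "x \<lessdot> y"
  shows "x \<in> carrier L" "y \<in> carrier L" "x \<sqsubseteq> y" "x \<noteq> y"
    "\<And>z. z \<in> carrier L \<Longrightarrow> x \<sqsubseteq> z \<Longrightarrow> z \<sqsubseteq> y \<Longrightarrow> z = x \<or> z = y"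
  using assms unfolding covering_eq by blast+

context modular_lattice
begin

text \<open>One half of the isomorphism between the intervals from \<open>a \<sqinter> b\<close> to
  \<open>a\<close> and from \<open>b\<close> to \<open>a \<squnion> b\<close>. For \<open>z\<close>
  in the upper interval the modular law recovers \<open>z\<close> as the join of \<open>b\<close>
  and \<open>a \<sqinter> z\<close>, and the covering leaves only two values for
  \<open>a \<sqinter> z\<close>.\<close>

lemma covering_transpose_up:
  assumes ab: "a \<in> carrier L" "b \<in> carrier L" and cov: "a \<sqinter> b \<lessdot> a"
  shows "b \<lessdot> a \<squnion> b"
  unfolding covering_eq
proof (intro conjI ballI impI)
  show "b \<noteq> a \<squnion> b"
    using coveringD(4)[OF cov] ab by (metis join_left le_iff_join)
  fix z assume z: "z \<in> carrier L" "b \<sqsubseteq> z" "z \<sqsubseteq> a \<squnion> b"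
  have "a \<sqinter> b \<sqsubseteq> a \<sqinter> z"
    using ab z by (meson le_trans meet_closed meet_le meet_left meet_right)
  then have "a \<sqinter> z = a \<sqinter> b \<or> a \<sqinter> z = a"
    using coveringD(5)[OF cov] ab z by (simp add: meet_left)
  moreover have "b \<squnion> (a \<sqinter> z) = z"
    using modular[of b a z] ab z by (simp add: join_comm[of L b a] meet_absorb2)
  moreover have "b \<squnion> (a \<sqinter> b) = b"
    using ab by (simp add: join_absorb1 meet_right)
  ultimately show "z = b \<or> z = a \<squnion> b"
    by (metis join_comm)
qed (use ab in \<open>simp_all add: join_right\<close>)

text \<open>The dual half: for \<open>z\<close> between \<open>a \<sqinter> b\<close> and
  \<open>a\<close>, the modular law recovers \<open>z\<close> as the meet of
  \<open>z \<squnion> b\<close> with \<open>a\<close>.\<close>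

lemma covering_transpose_down:
  assumes ab: "a \<in> carrier L" "b \<in> carrier L" and cov: "b \<lessdot> a \<squnion> b"
  shows "a \<sqinter> b \<lessdot> a"
  unfolding covering_eq
proof (intro conjI ballI impI)
  show "a \<sqinter> b \<noteq> a"
    using coveringD(4)[OF cov] ab by (metis le_iff_meet meet_right)
  fix z assume z: "z \<in> carrier L" "a \<sqinter> b \<sqsubseteq> z" "z \<sqsubseteq> a"
  have "z \<squnion> b \<sqsubseteq> a \<squnion> b"
    using ab z by (meson join_closed join_le join_left join_right le_trans)
  then have "z \<squnion> b = b \<or> z \<squnion> b = a \<squnion> b"
    using coveringD(5)[OF cov] ab z by (simp add: join_right)
  moreover have "z = (z \<squnion> b) \<sqinter> a"
    using modular[of z b a] ab z by (simp add: meet_comm[of L b a] join_absorb1)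
  moreover have "(a \<squnion> b) \<sqinter> a = a"
    using ab by (simp add: meet_absorb2 join_left)
  ultimately show "z = a \<sqinter> b \<or> z = a"
    by (metis meet_comm)
qed (use ab in \<open>simp_all add: meet_left\<close>)

end

section \<open>Existence of covers, and membership in maximal chains\<close>

text \<open>Among the elements strictly above \<open>a\<close> and at most \<open>b\<close>, one
  whose interval from \<open>a\<close> is smallest covers \<open>a\<close>: anything strictly
  between would have a smaller interval.\<close>

lemma (in partial_order) exists_upper_cover:
  assumes fin: "finite \<lbrace>a..b\<rbrace>" and ab: "a \<in> carrier L" "b \<in> carrier L" "a \<sqsubseteq> b" "a \<noteq> b"
  shows "\<exists>c. a \<lessdot> c \<and> c \<sqsubseteq> b"
proof -
  let ?P = "\<lambda>c. c \<in> carrier L \<and> a \<sqsubseteq> c \<and> a \<noteq> c \<and> c \<sqsubseteq> b"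
  let ?f = "\<lambda>c. card \<lbrace>a..c\<rbrace>"
  obtain c where c: "?P c" and least: "\<And>d. ?P d \<Longrightarrow> ?f c \<le> ?f d"
    using ex_has_least_nat[of ?P b ?f] ab by auto
  have "a \<lessdot> c"
    unfolding covering_eq
  proof (intro conjI ballI impI)
    fix z assume z: "z \<in> carrier L" "a \<sqsubseteq> z" "z \<sqsubseteq> c"
    show "z = a \<or> z = c"
    proof (rule ccontr)
      assume neg: "\<not> ?thesis"
      have "finite \<lbrace>a..c\<rbrace>"
        by (rule finite_subset[OF _ fin])
          (use c ab in \<open>auto simp: at_least_at_most_def intro: le_trans\<close>)
      moreover have "\<lbrace>a..z\<rbrace> \<subset> \<lbrace>a..c\<rbrace>"
        using c ab z neg by (auto simp: at_least_at_most_def intro: le_trans)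
      ultimately have "?f z < ?f c"
        by (rule psubset_card_mono)
      moreover have "?P z"
        using z neg c ab by (auto intro: le_trans)
      ultimately show False
        using least[of z] by simp
    qed
  qed (use c ab in auto)
  with c show ?thesis by blast
qed

lemma (in partial_order) exists_lower_cover:
  assumes fin: "finite \<lbrace>a..b\<rbrace>" and ab: "a \<in> carrier L" "b \<in> carrier L" "a \<sqsubseteq> b" "a \<noteq> b"
  shows "\<exists>c. a \<sqsubseteq> c \<and> c \<lessdot> b"
proof -
  let ?P = "\<lambda>c. c \<in> carrier L \<and> a \<sqsubseteq> c \<and> c \<noteq> b \<and> c \<sqsubseteq> b"
  let ?f = "\<lambda>c. card \<lbrace>c..b\<rbrace>"
  obtain c where c: "?P c" and least: "\<And>d. ?P d \<Longrightarrow> ?f c \<le> ?f d"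
    using ex_has_least_nat[of ?P a ?f] ab by auto
  have "c \<lessdot> b"
    unfolding covering_eq
  proof (intro conjI ballI impI)
    fix z assume z: "z \<in> carrier L" "c \<sqsubseteq> z" "z \<sqsubseteq> b"
    show "z = c \<or> z = b"
    proof (rule ccontr)
      assume neg: "\<not> ?thesis"
      have "finite \<lbrace>c..b\<rbrace>"
        by (rule finite_subset[OF _ fin])
          (use c ab in \<open>auto simp: at_least_at_most_def intro: le_trans\<close>)
      moreover have "\<lbrace>z..b\<rbrace> \<subset> \<lbrace>c..b\<rbrace>"
        using c ab z neg by (auto simp: at_least_at_most_def intro: le_trans)
      ultimately have "?f z < ?f c"
        by (rule psubset_card_mono)
      moreover have "?P z"
        using z neg c ab by (auto intro: le_trans)
      ultimately show False
        using least[of z] by simp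
    qed
  qed (use c ab in auto)
  with c show ?thesis by blast
qed

text \<open>Inserting \<open>z\<close> leaves a chain, so maximality forces it to be there already.
  This later shows that a maximal chain contains both ends of its interval and that its neighbours
  are coverings in all of \<open>L\<close>.\<close>

lemma (in partial_order) maximal_chain_mem:
  assumes C: "maximal_chain_between L a b C" and z: "z \<in> \<lbrace>a..b\<rbrace>"
    and cmp: "\<And>c. c \<in> C \<Longrightarrow> c \<sqsubseteq> z \<or> z \<sqsubseteq> c"
  shows "z \<in> C"
proof (rule ccontr)
  assume "z \<notin> C"
  moreover have "pred_on.chain \<lbrace>a..b\<rbrace> (\<lambda>x y. x \<sqsubset> y) (insert z C)"
  proof (rule pred_on.chainI)
    have chain: "pred_on.chain \<lbrace>a..b\<rbrace> (\<lambda>x y. x \<sqsubset> y) C"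
      using C by (simp add: maximal_chain_between_def pred_on.maxchain_def)
    show "insert z C \<subseteq> \<lbrace>a..b\<rbrace>"
      using chain z by (simp add: pred_on.chain_def)
    fix x y assume "x \<in> insert z C" "y \<in> insert z C"
    then show "(\<lambda>x y. x \<sqsubset> y)\<^sup>=\<^sup>= x y \<or> (\<lambda>x y. x \<sqsubset> y)\<^sup>=\<^sup>= y x"
      using pred_on.chain_total[OF chain, of x y] cmp[of x] cmp[of y] by (auto simp: lless_eq)
  qed
  ultimately show False
    using C unfolding maximal_chain_between_def pred_on.maxchain_def by blast
qed

section \<open>Ideals\<close>

text \<open>Ideals inherit meets, joins and coverings from \<open>L\<close>, so identities such as
  the modular law and projective constancy restrict to them.\<close>

locale lattice_ideal = lattice +
  fixes I
  assumes ideal_subset: "I \<subseteq> carrier L"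
    and ideal_down: "\<lbrakk>x \<in> carrier L; y \<in> I; x \<sqsubseteq> y\<rbrakk> \<Longrightarrow> x \<in> I"
    and ideal_join: "\<lbrakk>x \<in> I; y \<in> I\<rbrakk> \<Longrightarrow> x \<squnion> y \<in> I"
begin

abbreviation "LI \<equiv> L\<lparr>carrier := I\<rparr>"

lemma ideal_carrier: "x \<in> I \<Longrightarrow> x \<in> carrier L"
  using ideal_subset by blast

lemma partial_order_ideal: "partial_order LI"
  using weak_partial_order_subset[OF weak_partial_order_axioms ideal_subset]
  by (simp add: partial_order_def partial_order_axioms_def eq_is_equal)

lemma ideal_meet: "\<lbrakk>x \<in> I; y \<in> I\<rbrakk> \<Longrightarrow> x \<sqinter> y \<in> I"
  by (metis ideal_carrier ideal_down meet_closed meet_left)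

lemma is_lub_ideal:
  assumes "x \<in> I" "y \<in> I"
  shows "is_lub LI (x \<squnion> y) {x, y}"
  using assms unfolding least_def Upper_def
  by (auto simp: ideal_join ideal_carrier join_left join_right join_le)

lemma is_glb_ideal:
  assumes "x \<in> I" "y \<in> I"
  shows "is_glb LI (x \<sqinter> y) {x, y}"
  using assms unfolding greatest_def Lower_def
  by (auto simp: ideal_meet ideal_carrier meet_left meet_right meet_le)

lemma lattice_ideal_lattice: "lattice LI"
proof -
  interpret P: partial_order LI
    by (rule partial_order_ideal)
  show ?thesis
    by unfold_locales (use is_lub_ideal is_glb_ideal in \<open>simp; blast\<close>)+
qed

text \<open>Joins are chosen as some least upper bound, and the choice is made anew in
  \<open>LI\<close>; uniqueness of least upper bounds identifies the two results.\<close>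

lemma join_ideal:
  assumes "x \<in> I" "y \<in> I"
  shows "x \<squnion>\<^bsub>LI\<^esub> y = x \<squnion> y"
proof -
  interpret P: lattice LI
    by (rule lattice_ideal_lattice)
  have "is_lub LI (x \<squnion>\<^bsub>LI\<^esub> y) {x, y}"
    using assms by (simp add: join_def P.sup_of_two_least)
  from P.weak_least_unique[OF this is_lub_ideal[OF assms]] show ?thesis
    by (simp add: eq_is_equal)
qed

lemma meet_ideal:
  assumes "x \<in> I" "y \<in> I"
  shows "x \<sqinter>\<^bsub>LI\<^esub> y = x \<sqinter> y"
proof -
  interpret P: lattice LI
    by (rule lattice_ideal_lattice)
  have "is_glb LI (x \<sqinter>\<^bsub>LI\<^esub> y) {x, y}"
    using assms by (simp add: meet_def P.inf_of_two_greatest)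
  from P.weak_greatest_unique[OF this is_glb_ideal[OF assms]] show ?thesis
    by (simp add: eq_is_equal)
qed

text \<open>Down-closure puts \<open>x\<close> and everything between \<open>x\<close> and
  \<open>y\<close> into \<open>I\<close> as soon as \<open>y\<close> is there.\<close>

lemma covering_ideal: "x \<lessdot>\<^bsub>LI\<^esub> y \<longleftrightarrow> x \<lessdot> y \<and> y \<in> I"
proof -
  interpret P: partial_order LI
    by (rule partial_order_ideal)
  show ?thesis
    unfolding P.covering_eq covering_eq using ideal_carrier ideal_down by auto
qed

end

section \<open>Transposed coverings and the truncation\<close>

context fomin_lattice
begin

text \<open>Moving up one covering of \<open>x\<close> over \<open>u\<close> at a time, each move is an instance of
  projective constancy.\<close>

lemma weight_transpose:
  assumes "u \<lessdot> v" "x \<in> carrier L" "v \<sqinter> x = u"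
  shows "w u v = w x (v \<squnion> x)"
  using assms
proof (induction "card \<lbrace>u..x\<rbrace>" arbitrary: u v rule: less_induct)
  case less
  note u = coveringD(1)[OF less.prems(1)] and v = coveringD(2)[OF less.prems(1)]
  note uv = coveringD(3)[OF less.prems(1)] and x = less.prems(2)
  have ux: "u \<sqsubseteq> x" using less.prems(3) v x by (metis meet_right)
  show ?case
  proof (cases "u = x")
    case True
    then show ?thesis using u v uv by (simp add: join_absorb1)
  next
    case False
    then obtain u' where u': "u \<lessdot> u'" "u' \<sqsubseteq> x"
      using exists_upper_cover[OF locally_finite] u x ux by blast
    note u'c = coveringD(2)[OF u'(1)] and uu' = coveringD(3)[OF u'(1)]
    have "v \<sqinter> u' \<sqsubseteq> u"
      using less.prems(3) v x u'c u'(2)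
      by (metis meet_closed meet_le meet_left meet_right le_trans)
    then have meet: "v \<sqinter> u' = u"
      using u v u'c uv uu' by (meson le_antisym meet_closed meet_le)
    have c1: "u' \<lessdot> v \<squnion> u'"
      using covering_transpose_up[of v u'] meet less.prems(1) v u'c by simp
    have c2: "v \<lessdot> v \<squnion> u'"
      using covering_transpose_up[of u' v] meet u'(1) v u'c
      by (simp add: meet_comm[of L u'] join_comm[of L u'])
    have w1: "w u v = w u' (v \<squnion> u')"
      using projective_constant[of v u'] v u'c c1 c2 meet less.prems(1) u'(1) by simp
    \<comment> \<open>The modular law, with \<open>u'\<close> below \<open>x\<close>, shows that the
      transposed covering again meets \<open>x\<close> in its lower end, so the induction hypothesis
      applies to the shorter interval from \<open>u'\<close> to \<open>x\<close>.\<close>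
    have "(u' \<squnion> v) \<sqinter> x = u' \<squnion> (v \<sqinter> x)"
      using modular[of u' v x] u'c v x u'(2) by simp
    also have "\<dots> = u'"
      using less.prems(3) u'c u uu' by (simp add: join_absorb1)
    finally have meet': "(v \<squnion> u') \<sqinter> x = u'"
      by (simp add: join_comm)
    have "\<lbrace>u'..x\<rbrace> \<subset> \<lbrace>u..x\<rbrace>"
      using u u'c uu' ux x coveringD(4)[OF u'(1)]
      by (auto simp: at_least_at_most_def intro: le_trans)
    then have "card \<lbrace>u'..x\<rbrace> < card \<lbrace>u..x\<rbrace>"
      using locally_finite u x by (simp add: psubset_card_mono)
    then have "w u' (v \<squnion> u') = w x (v \<squnion> u' \<squnion> x)"
      using less.hyps c1 x meet' by blast
    moreover have "v \<squnion> u' \<squnion> x = v \<squnion> x"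
      by (rule le_antisym) (use v u'c x u'(2) in
          \<open>auto intro!: join_le intro: join_left join_right le_trans[OF _ join_right]
             le_trans[OF join_left join_left]\<close>)
    ultimately show ?thesis
      using w1 by simp
  qed
qed

section \<open>Elements without zero coverings below them\<close>

text \<open>A description of the truncation that mentions neither chains nor the minimum, which
  makes down-closure immediate; \<open>trunc_rel_iff\<close> identifies the two.\<close>

definition nonzero_below :: "'a set"
  where "nonzero_below = {x \<in> carrier L. \<forall>u v. u \<lessdot> v \<longrightarrow> v \<sqsubseteq> x \<longrightarrow> w u v \<noteq> 0}"

lemma nonzero_belowD:
  "\<lbrakk>x \<in> nonzero_below; u \<lessdot> v; v \<sqsubseteq> x\<rbrakk> \<Longrightarrow> w u v \<noteq> 0"
  by (auto simp: nonzero_below_def)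

lemma nonzero_below_carrier: "x \<in> nonzero_below \<Longrightarrow> x \<in> carrier L"
  by (simp add: nonzero_below_def)

lemma nonzero_below_down:
  "\<lbrakk>x \<in> carrier L; y \<in> nonzero_below; x \<sqsubseteq> y\<rbrakk> \<Longrightarrow> x \<in> nonzero_below"
  unfolding nonzero_below_def using coveringD(2) le_trans by blast

text \<open>A covering below \<open>y\<close> but not below \<open>x\<close> transposes either up to \<open>x \<lessdot> y\<close> or, by meeting
  with \<open>x\<close>, down to a covering below \<open>x\<close>.\<close>

lemma nonzero_below_cover:
  assumes x: "x \<in> nonzero_below" and xy: "x \<lessdot> y" and nz: "w x y \<noteq> 0"
  shows "y \<in> nonzero_below"
  unfolding nonzero_below_def
proof (intro CollectI conjI allI impI)
  note xc = coveringD(1)[OF xy] and yc = coveringD(2)[OF xy]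
  note xley = coveringD(3)[OF xy]
  show "y \<in> carrier L" by (rule yc)
  fix u v assume uv: "u \<lessdot> v" and vy: "v \<sqsubseteq> y"
  note uc = coveringD(1)[OF uv] and vc = coveringD(2)[OF uv] and uv_le = coveringD(3)[OF uv]
  \<comment> \<open>The join lies between \<open>x\<close> and \<open>y\<close> and differs from
    \<open>x\<close>, so the covering forces it to be \<open>y\<close>.\<close>
  have join_y: "a \<squnion> x = y" if "a \<in> carrier L" "a \<sqsubseteq> y" "\<not> a \<sqsubseteq> x" for a
    using coveringD(5)[OF xy, of "a \<squnion> x"] that xc yc xley
    by (metis join_closed join_le join_left join_right)
  consider "v \<sqsubseteq> x" | "\<not> v \<sqsubseteq> x" "u \<sqsubseteq> x" | "\<not> v \<sqsubseteq> x" "\<not> u \<sqsubseteq> x" by blast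
  then show "w u v \<noteq> 0"
  proof cases
    case 1
    then show ?thesis using nonzero_belowD[OF x uv] by simp
  next
    case 2
    \<comment> \<open>Here \<open>v\<close> meets \<open>x\<close> exactly in \<open>u\<close>, so
      the covering transposes up to the one from \<open>x\<close> to \<open>y\<close>.\<close>
    have "u \<sqsubseteq> v \<sqinter> x" using uc vc xc uv_le 2 by (simp add: meet_le)
    then have "v \<sqinter> x = u"
      using coveringD(5)[OF uv, of "v \<sqinter> x"] uc vc xc 2 by (metis meet_closed meet_left meet_right)
    then show ?thesis
      using weight_transpose[OF uv xc] join_y[of v] vc vy 2 nz by simp
  next
    case 3
    have uy: "u \<sqsubseteq> y" using le_trans[OF uv_le vy] uc vc yc by simp
    have cu: "u \<sqinter> x \<lessdot> u" and cv: "v \<sqinter> x \<lessdot> v"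
      using covering_transpose_down[of u x] covering_transpose_down[of v x]
        join_y[of u] join_y[of v] uc vc xc uy vy xy 3 by simp_all
    let ?m = "v \<sqinter> x"
    have mc: "?m \<in> carrier L" using vc xc by simp
    \<comment> \<open>Since \<open>v\<close> covers \<open>?m\<close>, having \<open>?m\<close>
      below \<open>u\<close> would give \<open>u = ?m\<close>, which is below \<open>x\<close>.
      Hence \<open>?m\<close> and \<open>u\<close> join to \<open>v\<close>, and the covering of
      \<open>?m\<close> over \<open>?m \<sqinter> u\<close> transposes up to
      \<open>u \<lessdot> v\<close>.\<close>
    have "\<not> ?m \<sqsubseteq> u"
    proof
      assume "?m \<sqsubseteq> u"
      then have "u = ?m"
        using coveringD(4)[OF uv] coveringD(5)[OF cv uc] uv_le by blast
      then show False using 3 vc xc by (metis meet_right)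
    qed
    then have "?m \<squnion> u \<noteq> u"
      using mc uc by (metis join_left)
    then have join: "?m \<squnion> u = v"
      using coveringD(5)[OF uv, of "?m \<squnion> u"] mc uc vc xc uv_le
      by (metis join_closed join_le join_right meet_left)
    then have cov: "?m \<sqinter> u \<lessdot> ?m"
      using covering_transpose_down[OF mc uc] uv by simp
    have "w (?m \<sqinter> u) ?m = w u v"
      using weight_transpose[OF cov uc HOL.refl] join by simp
    then show ?thesis
      using nonzero_belowD[OF x cov] vc xc by (metis meet_right)
  qed
qed

section \<open>Lattices with a minimum: joins and maximal chains\<close>

context
  fixes m
  assumes min: "least L m (carrier L)"
begin

lemma min_carrier: "m \<in> carrier L" and min_le: "x \<in> carrier L \<Longrightarrow> m \<sqsubseteq> x"
  using min by (auto simp: least_def)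

lemma min_nonzero_below: "m \<in> nonzero_below"
proof -
  have False if uv: "u \<lessdot> v" and v: "v \<sqsubseteq> m" for u v
  proof -
    note u = coveringD(1)[OF uv] and vc = coveringD(2)[OF uv]
    have "u \<sqsubseteq> m"
      using le_trans[OF coveringD(3)[OF uv] v] u vc min_carrier by simp
    then have "u = m" "v = m"
      using le_antisym v u vc min_carrier min_le by simp_all
    then show False using coveringD(4)[OF uv] by simp
  qed
  then show ?thesis
    using min_carrier by (auto simp: nonzero_below_def)
qed

text \<open>Induction down from \<open>y\<close> through a lower cover \<open>s\<close>. Either
  \<open>x \<squnion> s\<close> already equals \<open>x \<squnion> y\<close>, or the step between
  them is the transpose of \<open>s \<lessdot> y\<close>; its weight is then nonzero and
  \<open>nonzero_below_cover\<close> applies.\<close>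

lemma nonzero_below_join:
  assumes x: "x \<in> nonzero_below" and y: "y \<in> nonzero_below"
  shows "x \<squnion> y \<in> nonzero_below"
  using y
proof (induction "card \<lbrace>m..y\<rbrace>" arbitrary: y rule: less_induct)
  case less
  note xc = nonzero_below_carrier[OF x] and yc = nonzero_below_carrier[OF less.prems]
  show ?case
  proof (cases "y = m")
    case True
    then show ?thesis using x xc min_carrier min_le[OF xc] by (simp add: join_absorb1)
  next
    case False
    then obtain s where s: "s \<lessdot> y"
      using exists_lower_cover[OF locally_finite] min_carrier yc min_le[OF yc] by metis
    note sc = coveringD(1)[OF s] and sy = coveringD(3)[OF s]
    have "\<lbrace>m..s\<rbrace> \<subset> \<lbrace>m..y\<rbrace>"
      using sc yc sy coveringD(4)[OF s] min_le[OF yc]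
      by (auto simp: at_least_at_most_def intro: le_trans)
    then have "card \<lbrace>m..s\<rbrace> < card \<lbrace>m..y\<rbrace>"
      using locally_finite min_carrier yc by (simp add: psubset_card_mono)
    then have IH: "x \<squnion> s \<in> nonzero_below"
      using less.hyps nonzero_below_down[OF sc less.prems sy] by blast
    have xs: "x \<squnion> s \<in> carrier L" using xc sc by simp
    have join: "y \<squnion> (x \<squnion> s) = x \<squnion> y"
      by (rule le_antisym) (use xc yc sc sy in
          \<open>auto intro!: join_le intro: join_left join_right le_trans[OF _ join_right]
             le_trans[OF join_left join_right]\<close>)
    show ?thesis
    proof (cases "y \<sqsubseteq> x \<squnion> s")
      case True
      then show ?thesis using IH join xs yc by (metis le_iff_meet)
    next
      case False
      have "s \<sqsubseteq> y \<sqinter> (x \<squnion> s)"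
        using sc yc xc xs sy by (simp add: meet_le join_right)
      then have meet: "y \<sqinter> (x \<squnion> s) = s"
        using coveringD(5)[OF s, of "y \<sqinter> (x \<squnion> s)"] yc xs False
        by (metis meet_closed meet_left meet_right)
      have "x \<squnion> s \<lessdot> x \<squnion> y"
        using covering_transpose_up[OF yc xs] meet join s by simp
      moreover have "w (x \<squnion> s) (x \<squnion> y) \<noteq> 0"
        using weight_transpose[OF s xs meet] join nonzero_belowD[OF less.prems s] yc by simp
      ultimately show ?thesis
        using nonzero_below_cover[OF IH] by blast
    qed
  qed
qed

text \<open>Climb the chain from \<open>m\<close>: neighbours in it are coverings, and
  \<open>nonzero_below_cover\<close> carries membership across each. This yields the independence of
  the chosen chain.\<close>

lemma nonzero_below_maximal_chain:
  assumes C: "maximal_chain_between L m x C" and xc: "x \<in> carrier L"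
    and nz: "\<And>u v. \<lbrakk>u \<in> C; v \<in> C; u \<lessdot> v\<rbrakk> \<Longrightarrow> w u v \<noteq> 0"
  shows "x \<in> nonzero_below"
proof -
  have chain: "pred_on.chain \<lbrace>m..x\<rbrace> (\<lambda>x y. x \<sqsubset> y) C"
    using C unfolding maximal_chain_between_def pred_on.maxchain_def by blast
  then have sub: "C \<subseteq> \<lbrace>m..x\<rbrace>"
    unfolding pred_on.chain_def by blast
  have Cc: "c \<in> carrier L" "m \<sqsubseteq> c" "c \<sqsubseteq> x" if "c \<in> C" for c
    using subsetD[OF sub that] by (simp_all add: at_least_at_most_def)
  have tot: "c \<sqsubseteq> d \<or> d \<sqsubseteq> c" if "c \<in> C" "d \<in> C" for c d
    using pred_on.chain_total[OF chain that] Cc(1) that by (auto simp: lless_eq)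
  have finC: "finite C"
    using sub locally_finite[OF min_carrier xc] finite_subset by blast
  have mC: "m \<in> C"
    by (rule maximal_chain_mem[OF C]) (use min_carrier min_le xc Cc in \<open>auto simp: at_least_at_most_def\<close>)
  have xC: "x \<in> C"
    by (rule maximal_chain_mem[OF C]) (use min_carrier min_le xc Cc in \<open>auto simp: at_least_at_most_def\<close>)
  have "c \<in> nonzero_below" if "c \<in> C" for c
    using that
  proof (induction "card {d \<in> C. d \<sqsubseteq> c}" arbitrary: c rule: less_induct)
    case less
    show ?case
    proof (cases "c = m")
      case True
      then show ?thesis using min_nonzero_below by simp
    next
      case False
      let ?P = "\<lambda>d. d \<in> C \<and> d \<sqsubseteq> c \<and> d \<noteq> c"
      let ?f = "\<lambda>d. card {e \<in> C. e \<sqsubseteq> d}"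
      have smaller: "?f d < ?f e" if "d \<in> C" "e \<in> C" "d \<sqsubseteq> e" "d \<noteq> e" for d e
      proof (rule psubset_card_mono)
        have "{a \<in> C. a \<sqsubseteq> d} \<subseteq> {a \<in> C. a \<sqsubseteq> e}"
          using le_trans[OF _ that(3)] Cc(1) that by auto
        moreover have "e \<in> {a \<in> C. a \<sqsubseteq> e} - {a \<in> C. a \<sqsubseteq> d}"
          using le_antisym[OF that(3)] Cc(1) that by auto
        ultimately show "{a \<in> C. a \<sqsubseteq> d} \<subset> {a \<in> C. a \<sqsubseteq> e}"
          by blast
      qed (use finC in simp)
      \<comment> \<open>The predecessor \<open>d\<close> of \<open>c\<close> in the chain is found
        by maximizing the number of chain elements below; \<open>m\<close> is a candidate and the
        count at \<open>c\<close> is a bound.\<close>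
      have "?P m" using mC Cc(2)[OF less.prems] False by blast
      moreover have "\<forall>d. ?P d \<longrightarrow> ?f d < ?f c"
        using smaller[OF _ less.prems] by blast
      ultimately have "\<exists>d. ?P d \<and> (\<forall>e. ?P e \<longrightarrow> ?f e \<le> ?f d)"
        by (rule Lattices_Big.ex_has_greatest_nat)
      then obtain d where d: "?P d" and greatest: "\<And>e. ?P e \<Longrightarrow> ?f e \<le> ?f d"
        by blast
      have dc: "d \<lessdot> c"
        unfolding covering_eq
      proof (intro conjI ballI impI)
        fix z assume z: "z \<in> carrier L" "d \<sqsubseteq> z" "z \<sqsubseteq> c"
        have below: "e \<sqsubseteq> d" if e: "?P e" for e
        proof (rule ccontr)
          assume "\<not> e \<sqsubseteq> d"
          then have "?f d < ?f e" using smaller[of d e] tot[of d e] d e by blast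
          then show False using greatest[OF e] by simp
        qed
        \<comment> \<open>Every chain element is above \<open>c\<close> or at most \<open>d\<close>,
          hence comparable with \<open>z\<close>; so \<open>z\<close> is in the chain, where nothing
          lies strictly between \<open>d\<close> and \<open>c\<close>.\<close>
        have "z \<in> C"
        proof (rule maximal_chain_mem[OF C])
          show "z \<in> \<lbrace>m..x\<rbrace>"
            using z min_le Cc[OF less.prems] xc by (auto simp: at_least_at_most_def intro: le_trans)
          fix e assume e: "e \<in> C"
          show "e \<sqsubseteq> z \<or> z \<sqsubseteq> e"
          proof (cases "c \<sqsubseteq> e")
            case True
            then show ?thesis using z e less.prems Cc by (meson le_trans)
          next
            case False
            then have "?P e" using e tot[OF e less.prems] Cc(1)[OF e] by auto
            then show ?thesis using below[of e] z e d Cc by (meson le_trans)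
          qed
        qed
        then show "z = d \<or> z = c"
          using below[of z] z d Cc by blast
      qed (use d Cc less.prems in auto)
      have "d \<in> nonzero_below"
        using less.hyps[of d] smaller[of d c] d less.prems by blast
      then show ?thesis
        using nonzero_below_cover dc nz d less.prems by blast
    qed
  qed
  then show ?thesis using xC by blast
qed

section \<open>The truncation as an ideal and as a Fomin lattice\<close>

text \<open>Against the minimum the interval is the one from \<open>m\<close> to \<open>x\<close>.
  One direction climbs the given chain; for the other any maximal chain serves, because its
  coverings lie below \<open>x\<close>.\<close>

lemma trunc_rel_iff:
  assumes xc: "x \<in> carrier L"
  shows "trunc_rel L w x m \<longleftrightarrow> x \<in> nonzero_below"
proof -
  have eqs: "x \<sqinter> m = m" "x \<squnion> m = x"
    using xc min_carrier min_le[OF xc] by (simp_all add: meet_absorb2 join_absorb1)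
  show ?thesis
  proof
    assume "trunc_rel L w x m"
    then show "x \<in> nonzero_below"
      using nonzero_below_maximal_chain[OF _ xc]
      unfolding trunc_rel_def eqs zero_coverings_def by blast
  next
    assume x: "x \<in> nonzero_below"
    obtain C where C: "maximal_chain_between L m x C"
      unfolding maximal_chain_between_def using pred_on.Hausdorff by blast
    then have "C \<subseteq> \<lbrace>m..x\<rbrace>"
      unfolding maximal_chain_between_def pred_on.maxchain_def pred_on.chain_def by blast
    then have "\<forall>u\<in>C. \<forall>v\<in>C. u \<lessdot> v \<longrightarrow> (u, v) \<notin> zero_coverings L w"
      using nonzero_belowD[OF x] by (auto simp: zero_coverings_def at_least_at_most_def)
    with C show "trunc_rel L w x m"
      unfolding trunc_rel_def eqs by blast
  qed
qed

lemma truncation_eq: "truncation L w m = L\<lparr>carrier := nonzero_below\<rparr>"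
proof -
  have "{x \<in> carrier L. trunc_rel L w x m} = nonzero_below"
    using trunc_rel_iff nonzero_below_carrier by blast
  then show ?thesis by (simp add: truncation_def)
qed

lemma lattice_ideal_nonzero_below: "lattice_ideal L nonzero_below"
proof (intro lattice_ideal.intro lattice_ideal_axioms.intro lattice_axioms)
  show "nonzero_below \<subseteq> carrier L"
    using nonzero_below_carrier by blast
qed (fact nonzero_below_down nonzero_below_join)+

lemma fomin_lattice_truncation: "fomin_lattice (truncation L w m) w r"
proof -
  interpret I: lattice_ideal L nonzero_below
    by (rule lattice_ideal_nonzero_below)
  interpret T: lattice I.LI
    by (rule I.lattice_ideal_lattice)
  have "fomin_lattice I.LI w r"
  proof (intro fomin_lattice.intro modular_lattice.intro modular_lattice_axioms.intro
      fomin_lattice_axioms.intro T.lattice_axioms)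
    fix x y z assume "x \<in> carrier I.LI" "y \<in> carrier I.LI" "z \<in> carrier I.LI" "x \<sqsubseteq>\<^bsub>I.LI\<^esub> z"
    then show "x \<squnion>\<^bsub>I.LI\<^esub> (y \<sqinter>\<^bsub>I.LI\<^esub> z) = (x \<squnion>\<^bsub>I.LI\<^esub> y) \<sqinter>\<^bsub>I.LI\<^esub> z"
      by (simp add: I.join_ideal I.meet_ideal I.ideal_join I.ideal_meet I.ideal_carrier modular)
  next
    fix x y assume "x \<in> carrier I.LI" "y \<in> carrier I.LI"
    then have "finite \<lbrace>x..y\<rbrace>"
      by (simp add: locally_finite I.ideal_carrier)
    then show "finite \<lbrace>x..y\<rbrace>\<^bsub>I.LI\<^esub>"
      by (rule rev_finite_subset) (auto simp: at_least_at_most_def I.ideal_carrier)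
  next
    fix x assume "x \<in> carrier I.LI"
    then show "finite {z. x \<lessdot>\<^bsub>I.LI\<^esub> z}"
      using finite_upper_covers[of x] by (simp add: I.covering_ideal I.ideal_carrier)
  next
    fix x assume "x \<in> carrier I.LI"
    then show "finite {y. y \<lessdot>\<^bsub>I.LI\<^esub> x}"
      using finite_lower_covers[of x] by (simp add: I.covering_ideal I.ideal_carrier)
  next
    fix x assume "x \<in> carrier I.LI"
    then have x: "x \<in> nonzero_below" and xc: "x \<in> carrier L"
      by (simp_all add: I.ideal_carrier)
    \<comment> \<open>As \<open>x\<close> is in the ideal, its lower covers are the same as in
      \<open>L\<close>.\<close>
    have "(\<Sum>y | y \<lessdot>\<^bsub>I.LI\<^esub> x. w y x) + r = (\<Sum>z | x \<lessdot> z. w x z)"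
      using differential[OF xc] x by (simp add: I.covering_ideal)
    \<comment> \<open>the upper covers lost by truncating have weight zero\<close>
    also have "\<dots> = (\<Sum>z | x \<lessdot>\<^bsub>I.LI\<^esub> z. w x z)"
      by (rule sum.mono_neutral_right[OF finite_upper_covers[OF xc]])
        (use nonzero_below_cover[OF x] in \<open>auto simp: I.covering_ideal\<close>)
    finally show "(\<Sum>y | y \<lessdot>\<^bsub>I.LI\<^esub> x. w y x) + r = (\<Sum>z | x \<lessdot>\<^bsub>I.LI\<^esub> z. w x z)" .
  next
    fix x y
    assume "x \<in> carrier I.LI" "y \<in> carrier I.LI"
      "x \<lessdot>\<^bsub>I.LI\<^esub> x \<squnion>\<^bsub>I.LI\<^esub> y" "y \<lessdot>\<^bsub>I.LI\<^esub> x \<squnion>\<^bsub>I.LI\<^esub> y"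
      "x \<sqinter>\<^bsub>I.LI\<^esub> y \<lessdot>\<^bsub>I.LI\<^esub> x" "x \<sqinter>\<^bsub>I.LI\<^esub> y \<lessdot>\<^bsub>I.LI\<^esub> y"
    then show "w (x \<sqinter>\<^bsub>I.LI\<^esub> y) x = w y (x \<squnion>\<^bsub>I.LI\<^esub> y) \<and>
        w (x \<sqinter>\<^bsub>I.LI\<^esub> y) y = w x (x \<squnion>\<^bsub>I.LI\<^esub> y)"
      using projective_constant[of x y]
      by (simp add: I.join_ideal I.meet_ideal I.covering_ideal I.ideal_carrier)
  qed
  then show ?thesis
    by (simp add: truncation_eq)
qed

lemma least_truncation:
  "least (truncation L w m) m (carrier (truncation L w m))"
  using min_nonzero_below min_le nonzero_below_carrier
  by (auto simp: truncation_eq least_def)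

lemma covering_truncation:
  "x \<lessdot>\<^bsub>truncation L w m\<^esub> y \<longleftrightarrow> x \<lessdot> y \<and> y \<in> nonzero_below"
  unfolding truncation_eq
  by (rule lattice_ideal.covering_ideal[OF lattice_ideal_nonzero_below])

end

end

theorem theorem4p18:
  fixes L :: "('a, 'm) gorder_scheme"
    and w :: "'a \<Rightarrow> 'a \<Rightarrow> int"
    and r :: int
    and min0 :: 'a
  assumes "fomin_lattice L w r"
    and "least L min0 (carrier L)"
    and "0 < r"
    and "\<And>x y. x \<lessdot>\<^bsub>L\<^esub> y \<Longrightarrow> w x y < 0 \<Longrightarrow>
      \<exists>z v. z \<lessdot>\<^bsub>L\<^esub> v \<and> v \<sqsubseteq>\<^bsub>L\<^esub> x \<and> w z v = 0"
  shows "fomin_lattice (truncation L w min0) w r \<and>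
    least (truncation L w min0) min0 (carrier (truncation L w min0)) \<and>
    positive_weighting (truncation L w min0) w r"
proof -
  interpret fomin_lattice L w r by fact
  have "0 < w x y" if "x \<lessdot>\<^bsub>truncation L w min0\<^esub> y" for x y
  proof -
    have xy: "x \<lessdot>\<^bsub>L\<^esub> y" and y: "y \<in> nonzero_below"
      using that covering_truncation[OF assms(2)] by auto
    have x: "x \<in> nonzero_below"
      using nonzero_below_down[OF _ y] coveringD[OF xy] by blast
    have "w x y \<noteq> 0"
      using nonzero_belowD[OF y xy] nonzero_below_carrier[OF y] by simp
    \<comment> \<open>A negative weight would, by hypothesis, produce a zero covering below
      \<open>x\<close>.\<close>
    moreover have "\<not> w x y < 0"
      using assms(4)[OF xy] nonzero_belowD[OF x] by blast
    ultimately show ?thesis by simp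
  qed
  then show ?thesis
    using fomin_lattice_truncation[OF assms(2)] least_truncation[OF assms(2)] assms(3)
    by (simp add: positive_weighting_def)
qed

end
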